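(* Let $f:\mathbb{R}^n\to\mathbb{R}$ be $L$-smooth (not necessarily convex), let $\varepsilon>0$, $\tilde\mu>0$, $0<M_0\le4L$, and let $y_0\in\mathbb{R}^n$ with $\|\nabla f(y_0)\|>\varepsilon$. Then the algorithm $\text{SCAR-PM}(f,\varepsilon,y_0,\tilde\mu,M_0)$ (described in the context) will either find an approximate solution $\hat x$ with $\|\nabla f(\hat x)\|\le\varepsilon$, or report that $f$ is not $\tilde\mu$-strongly convex by returning ERROR = TRUE. It terminates after at most $$\left(4+C_1\sqrt{10L/\tilde\mu}\right)\left\lceil\log_2\frac{\|\nabla f(y_0)\|}{\varepsilon}\right\rceil$$ gradient evaluations, where $C_1:=\sqrt2\,(3+16\sqrt{2c_{\mathcal A}})$ is a universal constant. Moreover, if $\tilde\mu\le2^j\varepsilon/\operatorname{dist}(y_0,X^* )$ for some integer $j$, an alternative bound on the number of gradient evaluations is $\left(4+C_1\sqrt{10L/\tilde\mu}\right)\max\{1,j\}$.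
   Context: $\|\cdot\|$ is the Euclidean norm; $X^*$ is the set of optimal solutions of $\min_{x\in\mathbb{R}^n}f(x)$, and $\operatorname{dist}(y_0,X^* )=\min_{x^*\in X^*}\|y_0-x^*\|$. $L$-smooth means differentiable with $\|\nabla f(x)-\nabla f(y)\|\le L\|x-y\|$ for all $x,y$; $\tilde\mu$-strongly convex means $f(x)\ge f(y)+\langle\nabla f(y),x-y\rangle+\frac{\tilde\mu}{2}\|x-y\|^2$ for all $x,y$. Backtracking$(g,\sigma,x,M_0)$: for $j=0,1,\dots$ set $x^{++}=x-\frac{1}{2(M_j+\sigma)}\nabla g(x)$; if $g(x^{++})-g(x)-\langle\nabla g(x),x^{++}-x\rangle\le\frac{M_j+\sigma}{2}\|x^{++}-x\|^2$, terminate and return $M=M_j$; otherwise set $M_{j+1}=2M_j$. (Only one gradient, at $x$, is used.) AR method $(\hat x,M)=\mathrm{AR}(f,x_0,\sigma_1,M_0)$: set $\overline{x}_0=x_0$, $\sigma_0=0$. For $s=1,2,\dots$: if $s>1$ set $\sigma_s=4\sigma_{s-1}$; set $\overline{x}_s=(1-\gamma_s)\overline{x}_{s-1}+\gamma_sx_{s-1}$ with $\gamma_s=1-\sigma_{s-1}/\sigma_s$; compute an approximate solution $x_s$ of $x_s^*:=\operatorname{argmin}_{x\in\mathbb{R}^n}\{f_s(x):=f(x)+\frac{\sigma_s}{2}\|x-\overline{x}_s\|^2\}$ by running a subroutine $x_s=\mathcal{A}(f,\sigma_s,\overline{x}_s,x_{s-1})$ with initial point $x_{s-1}$; set $M_s=\text{Backtracking}(f_s,\sigma_s,x_s,M_{s-1}/2)$;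 if $\sigma_s\ge M_s$, terminate with $\hat x=x_s$, $M=M_s$. Assumption on the subroutine $\mathcal{A}$: after its $k$-th gradient evaluation of $\nabla f$ it has computed a point $x_s^k$ and an estimate $L_s^k$ of $L$ with $L_s^k\le c_{\mathcal A}L$, where $c_{\mathcal A}$ is a universal constant depending on $\mathcal{A}$; if moreover the input function $f$ is convex, then $f_s(x_s^k)-f_s(x_s^* )\le\frac{L_s^k}{k^2}\|x_{s-1}-x_s^*\|^2$. It terminates whenever $k\ge8\sqrt{2L_s^k/\sigma_s}$ and outputs $x_s=x_s^k$ (regardless of convexity). SCAR-PM: $(\hat x,\hat M,\mathrm{ERROR})=\text{SCAR-PM}(f,\varepsilon,y_0,\tilde\mu,M_0)$: for $t=1,2,\dots$: set $(y_t,M_t)=\mathrm{AR}(f,y_{t-1},\tilde\mu/10,M_{t-1})$; if $\|\nabla f(y_t)\|\le\varepsilon$, terminate with $\hat x=y_t$, $\hat M=M_t$, ERROR = FALSE; if $\|\nabla f(y_t)\|>\|\nabla f(y_{t-1})\|/2$, terminate with $\hat x=y_0$, $\hat M=M_t$, ERROR = TRUE.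
   Formalization: The alternative bound with max{1,j} is stated only for convex f; for nonconvex L-smooth f it is false, since the subroutine then promises nothing about its output (e.g. f = cos, y_0 = π/2, ε = μ̃ = 1/10, j = 1). *)

theory Defs
  imports "HOL-Analysis.Analysis" "HOL-Library.Monad_Syntax"
begin

definition grad :: "('a::real_inner \<Rightarrow> real) \<Rightarrow> 'a \<Rightarrow> 'a" where
  "grad f x = (THE D. GDERIV f x :> D)"

definition L_smooth :: "real \<Rightarrow> ('a::real_inner \<Rightarrow> real) \<Rightarrow> bool" where
  "L_smooth L f \<longleftrightarrow> (\<forall>x. f differentiable (at x)) \<and>
     (\<forall>x y. norm (grad f x - grad f y) \<le> L * norm (x - y))"

text \<open>Used only for differentiable functions, where \<open>grad\<close> is meaningful.\<close>

definition strongly_convex :: "real \<Rightarrow> ('a::real_inner \<Rightarrow> real) \<Rightarrow> bool" where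
  "strongly_convex \<mu> f \<longleftrightarrow>
     (\<forall>x y. f x \<ge> f y + grad f y \<bullet> (x - y) + \<mu> / 2 * (norm (x - y))\<^sup>2)"

definition minimizers :: "('a \<Rightarrow> real) \<Rightarrow> 'a set" where
  "minimizers f = {x. is_arg_min f (\<lambda>_. True) x}"

definition proximal :: "('a::real_inner \<Rightarrow> real) \<Rightarrow> real \<Rightarrow> 'a \<Rightarrow> 'a \<Rightarrow> real" where
  "proximal f \<sigma> xbar x = f x + \<sigma> / 2 * (norm (x - xbar))\<^sup>2"

text \<open>
  The algorithms are deterministic partial functions into \<open>option\<close>, defined as least fixed
  points: \<open>None\<close> means that the algorithm does not terminate. The last component of a
  result is the number of gradient evaluations spent.

  A subroutine is represented by its sequence of iterates: \<open>A f \<sigma> xbar x0 k\<close> is the pair of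
  the point and the estimate of \<open>L\<close> that are available after the \<open>k\<close>-th evaluation of the gradient
  of \<open>f\<close>, for \<open>k \<ge> 1\<close>.
\<close>

type_synonym 'a subroutine = "('a \<Rightarrow> real) \<Rightarrow> real \<Rightarrow> 'a \<Rightarrow> 'a \<Rightarrow> nat \<Rightarrow> 'a \<times> real"

text \<open>
  The assumption on the subroutine, for one function \<open>f\<close> and one smoothness constant \<open>L\<close>. The
  convergence guarantee is only required for convex \<open>f\<close>; in that case (with \<open>\<sigma> > 0\<close>) the
  proximal function has exactly one minimizer. Nonnegativity of the estimate makes the
  square root in the stopping rule meaningful.
\<close>

definition subroutine_assumption ::
    "'a::real_inner subroutine \<Rightarrow> real \<Rightarrow> real \<Rightarrow> ('a \<Rightarrow> real) \<Rightarrow> bool" where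
  "subroutine_assumption A cA L f \<longleftrightarrow>
     (\<forall>\<sigma>>0. \<forall>xbar x0. \<forall>k\<ge>1. case A f \<sigma> xbar x0 k of (xk, Lk) \<Rightarrow>
        0 \<le> Lk \<and> Lk \<le> cA * L \<and>
        (convex_on UNIV f \<longrightarrow>
          (\<forall>xs\<in>minimizers (proximal f \<sigma> xbar).
             proximal f \<sigma> xbar xk - proximal f \<sigma> xbar xs
               \<le> Lk / (real k)\<^sup>2 * (norm (x0 - xs))\<^sup>2)))"

partial_function (option) subroutine_loop ::
    "'a::real_inner subroutine \<Rightarrow> ('a \<Rightarrow> real) \<Rightarrow> real \<Rightarrow> 'a \<Rightarrow> 'a \<Rightarrow> nat \<Rightarrow> ('a \<times> nat) option" where
  "subroutine_loop A f \<sigma> xbar x0 k =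
     (let (xk, Lk) = A f \<sigma> xbar x0 k in
      if real k \<ge> 8 * sqrt (2 * Lk / \<sigma>) then Some (xk, k)
      else subroutine_loop A f \<sigma> xbar x0 (k + 1))"

definition run_subroutine ::
    "'a::real_inner subroutine \<Rightarrow> ('a \<Rightarrow> real) \<Rightarrow> real \<Rightarrow> 'a \<Rightarrow> 'a \<Rightarrow> ('a \<times> nat) option" where
  "run_subroutine A f \<sigma> xbar x0 = subroutine_loop A f \<sigma> xbar x0 1"

partial_function (option) backtracking_loop ::
    "('a::real_inner \<Rightarrow> real) \<Rightarrow> real \<Rightarrow> 'a \<Rightarrow> 'a \<Rightarrow> real \<Rightarrow> real option" where
  "backtracking_loop g \<sigma> x d M =
     (let x' = x - (1 / (2 * (M + \<sigma>))) *\<^sub>R d in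
      if g x' - g x - d \<bullet> (x' - x) \<le> (M + \<sigma>) / 2 * (norm (x' - x))\<^sup>2 then Some M
      else backtracking_loop g \<sigma> x d (2 * M))"

text \<open>The only gradient that is evaluated is \<open>d = grad g x\<close>, whence the cost 1.\<close>

definition backtracking ::
    "('a::real_inner \<Rightarrow> real) \<Rightarrow> real \<Rightarrow> 'a \<Rightarrow> real \<Rightarrow> (real \<times> nat) option" where
  "backtracking g \<sigma> x M0 = do {
     M \<leftarrow> backtracking_loop g \<sigma> x (grad g x) M0;
     Some (M, 1) }"

text \<open>
  In stage \<open>s\<close> the arguments of \<open>ar_loop\<close> stand for \<open>x\<close>, \<open>xbar\<close> and \<open>\<sigma>\<close> of index \<open>s - 1\<close>, for \<open>\<sigma>\<close> of
  index \<open>s\<close>, for \<open>M\<close> of index \<open>s - 1\<close>, and for the number of gradient evaluations made so far.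
\<close>

partial_function (option) ar_loop ::
    "'a::real_inner subroutine \<Rightarrow> ('a \<Rightarrow> real) \<Rightarrow> 'a \<Rightarrow> 'a \<Rightarrow> real \<Rightarrow> real \<Rightarrow> real \<Rightarrow> nat
      \<Rightarrow> ('a \<times> real \<times> nat) option" where
  "ar_loop A f x_prev xbar_prev \<sigma>_prev \<sigma> M_prev N =
     (let \<gamma> = 1 - \<sigma>_prev / \<sigma>;
          xbar = (1 - \<gamma>) *\<^sub>R xbar_prev + \<gamma> *\<^sub>R x_prev
      in do {
        (x, k) \<leftarrow> run_subroutine A f \<sigma> xbar x_prev;
        (M, b) \<leftarrow> backtracking (proximal f \<sigma> xbar) \<sigma> x (M_prev / 2);
        if \<sigma> \<ge> M then Some (x, M, N + k + b)
        else ar_loop A f x xbar \<sigma> (4 * \<sigma>) M (N + k + b)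
      })"

definition ar ::
    "'a::real_inner subroutine \<Rightarrow> ('a \<Rightarrow> real) \<Rightarrow> 'a \<Rightarrow> real \<Rightarrow> real \<Rightarrow> ('a \<times> real \<times> nat) option" where
  "ar A f x0 \<sigma>1 M0 = ar_loop A f x0 x0 0 \<sigma>1 M0 0"

text \<open>
  The arguments \<open>y\<close> and \<open>M\<close> of \<open>scar_pm_loop\<close> have index \<open>t - 1\<close>. A result consists of the
  returned point, the returned estimate, the value of ERROR and the number of gradient evaluations.
  The count is conservative: besides the evaluations in the calls of \<open>ar\<close>, it includes one for
  the gradient at \<open>y0\<close> and one for the gradient at every further \<open>y\<close> that is tested, although the
  latter has already been evaluated in the last call of \<open>backtracking\<close>.
\<close>

partial_function (option) scar_pm_loop ::
    "'a::real_inner subroutine \<Rightarrow> ('a \<Rightarrow> real) \<Rightarrow> real \<Rightarrow> 'a \<Rightarrow> real \<Rightarrow> 'a \<Rightarrow> real \<Rightarrow> nat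
      \<Rightarrow> ('a \<times> real \<times> bool \<times> nat) option" where
  "scar_pm_loop A f \<epsilon> y0 \<mu> y M N = do {
     (y', M', k) \<leftarrow> ar A f y (\<mu> / 10) M;
     if norm (grad f y') \<le> \<epsilon> then Some (y', M', False, N + k + 1)
     else if norm (grad f y') > norm (grad f y) / 2 then Some (y0, M', True, N + k + 1)
     else scar_pm_loop A f \<epsilon> y0 \<mu> y' M' (N + k + 1)
   }"

definition scar_pm ::
    "'a::real_inner subroutine \<Rightarrow> ('a \<Rightarrow> real) \<Rightarrow> real \<Rightarrow> 'a \<Rightarrow> real \<Rightarrow> real
      \<Rightarrow> ('a \<times> real \<times> bool \<times> nat) option" where
  "scar_pm A f \<epsilon> y0 \<mu> M0 = scar_pm_loop A f \<epsilon> y0 \<mu> y0 M0 1"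

definition C1 :: "real \<Rightarrow> real" where
  "C1 cA = sqrt 2 * (3 + 16 * sqrt (2 * cA))"

end

theory Submission
  imports Defs
begin

text \<open>
  The gradient at the result of the AR method is bounded by a multiple of the distance from its
  starting point to a minimizer: \<open>norm (grad f y') \<le> 9 / 4 * \<sigma>1 * norm (y - p)\<close> for convex \<open>f\<close>,
  whatever the number of stages. Everything about SCAR-PM follows from this and from a bound on the
  cost of one call.

  Two facts give the gradient bound. In every stage the minimizer of the proximal function is at
  least as close to the last iterate as the previous one was, because the new quadratic term is the
  old one plus a term centred at this iterate (\<open>proximal_minimizer_approaches_center\<close>). And the
  stopping rule makes the inexact proximal step a contraction by the factor \<open>8\<close>
  (\<open>inexact_proximal_step\<close>). As \<open>\<sigma>\<close> is multiplied by \<open>4\<close>, the distances weighted by \<open>\<sigma>\<close> still decay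
  geometrically, so that they can be summed along the stages. In the last stage the estimate \<open>M\<close> is
  at most \<open>\<sigma>\<close>, and the accepted gradient step bounds the gradient of the proximal function
  (\<open>accepted_step_imp_norm_le_gap\<close>); that of \<open>f\<close> differs from it by \<open>\<sigma> * norm (x - c)\<close>, where \<open>c\<close> is the proximal
  center. The induction over the stages (\<open>ar_stage\<close>, \<open>ar_loop_correct\<close>) carries both terms in one
  potential.

  The cost does not depend on convexity. Backtracking never leads beyond \<open>2 * L\<close>, so the number of
  stages is logarithmic in \<open>L / \<sigma>1\<close>, while the subroutine costs form a geometric series dominated by
  its first term, of order \<open>sqrt (L / \<sigma>1)\<close> (\<open>ar_correct\<close>).

  With \<open>\<sigma>1 = \<mu> / 10\<close> the gradient bound is at most \<open>\<mu> / 2 * norm (y - p)\<close>. If \<open>f\<close> is \<open>\<mu>\<close>-strongly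
  convex, \<open>\<mu> * norm (y - p) \<le> norm (grad f y)\<close>, hence every call halves the gradient and a failure to
  do so refutes strong convexity. As the loop continues only after a halving, the number of calls is
  at most the logarithm in the theorem. For the alternative bound, the first call alone brings the
  gradient down to \<open>2 powi (j - 1) * \<epsilon>\<close>, and halving is counted from there.
\<close>


section \<open>Gradients and convexity\<close>

lemma grad_eqI:
  assumes "GDERIV f x :> D"
  shows "grad f x = D"
  unfolding grad_def
proof (rule the_equality)
  fix D' assume "GDERIV f x :> D'"
  then have "(\<lambda>h. inner h D') = (\<lambda>h. inner h D)"
    using assms has_derivative_unique unfolding gderiv_def by blast
  then show "D' = D"
    by (metis inner_commute vector_eq_ldot)
qed (fact assms)

lemma GDERIV_grad:
  fixes f :: "'a::euclidean_space \<Rightarrow> real"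
  assumes "f differentiable (at x)"
  shows "GDERIV f x :> grad f x"
proof -
  from assms obtain f' where f': "(f has_derivative f') (at x)"
    unfolding differentiable_def by blast
  then interpret f': bounded_linear f'
    by (rule has_derivative_bounded_linear)
  \<comment> \<open>The Riesz representative of the derivative, assembled coordinatewise.\<close>
  have "f' h = h \<bullet> (\<Sum>b\<in>Basis. f' b *\<^sub>R b)" for h
  proof -
    have "f' h = f' (\<Sum>b\<in>Basis. (h \<bullet> b) *\<^sub>R b)"
      by (simp add: euclidean_representation)
    also have "\<dots> = h \<bullet> (\<Sum>b\<in>Basis. f' b *\<^sub>R b)"
      by (simp add: f'.sum f'.scaleR inner_sum_right mult.commute)
    finally show ?thesis .
  qed
  then have "f' = (\<lambda>h. h \<bullet> (\<Sum>b\<in>Basis. f' b *\<^sub>R b))"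
    by blast
  with f' have "GDERIV f x :> (\<Sum>b\<in>Basis. f' b *\<^sub>R b)"
    unfolding gderiv_def by metis
  then show ?thesis
    using grad_eqI by metis
qed

lemma grad_minimizer_eq_0:
  fixes f :: "'a::euclidean_space \<Rightarrow> real"
  assumes "f differentiable (at p)" "p \<in> minimizers f"
  shows "grad f p = 0"
proof -
  have "(\<lambda>h. h \<bullet> grad f p) = (\<lambda>h. 0)"
    using GDERIV_grad[OF assms(1)] assms(2)
    by (intro has_derivative_local_min)
       (auto simp: gderiv_def minimizers_def is_arg_min_linorder)
  then show ?thesis
    by (metis inner_eq_zero_iff)
qed

lemma DERIV_along_line:
  fixes f :: "'a::euclidean_space \<Rightarrow> real"
  assumes "f differentiable (at (y + t *\<^sub>R h))"
  shows "((\<lambda>t. f (y + t *\<^sub>R h)) has_real_derivative grad f (y + t *\<^sub>R h) \<bullet> h) (at t)"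
proof -
  have "((\<lambda>t. y + t *\<^sub>R h) has_derivative (\<lambda>s. s *\<^sub>R h)) (at t)"
    by (auto intro!: derivative_eq_intros)
  moreover have "(f has_derivative (\<lambda>h'. h' \<bullet> grad f (y + t *\<^sub>R h))) (at (y + t *\<^sub>R h))"
    using GDERIV_grad[OF assms] by (simp add: gderiv_def)
  ultimately have "((\<lambda>t. f (y + t *\<^sub>R h)) has_derivative
      (\<lambda>s. (s *\<^sub>R h) \<bullet> grad f (y + t *\<^sub>R h))) (at t)"
    by (rule has_derivative_compose)
  then show ?thesis
    by (simp add: has_field_derivative_def inner_commute mult_commute_abs)
qed

lemma convex_on_above_tangent:
  fixes f :: "'a::euclidean_space \<Rightarrow> real"
  assumes "convex_on UNIV f" "f differentiable (at y)"
  shows "f x \<ge> f y + grad f y \<bullet> (x - y)"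
proof -
  let ?\<phi> = "\<lambda>t::real. f (y + t *\<^sub>R (x - y))"
  have "convex_on UNIV ?\<phi>"
  proof (rule convex_onI)
    fix t a b :: real assume t: "0 < t" "t < 1"
    have "y + ((1 - t) *\<^sub>R a + t *\<^sub>R b) *\<^sub>R (x - y)
        = (1 - t) *\<^sub>R (y + a *\<^sub>R (x - y)) + t *\<^sub>R (y + b *\<^sub>R (x - y))"
      by (simp add: algebra_simps)
    then show "?\<phi> ((1 - t) *\<^sub>R a + t *\<^sub>R b) \<le> (1 - t) * ?\<phi> a + t * ?\<phi> b"
      using convex_onD[OF assms(1), of t "y + a *\<^sub>R (x - y)" "y + b *\<^sub>R (x - y)"] t by simp
  qed simp
  moreover have "(?\<phi> has_real_derivative grad f y \<bullet> (x - y)) (at 0)"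
    using DERIV_along_line[of f y 0 "x - y"] assms(2) by simp
  ultimately have "?\<phi> 1 - ?\<phi> 0 \<ge> grad f y \<bullet> (x - y) * (1 - 0)"
    by (intro convex_on_imp_above_tangent[where A = UNIV]) auto
  then show ?thesis by simp
qed

lemma strongly_convex_imp_convex_on:
  fixes f :: "'a::euclidean_space \<Rightarrow> real"
  assumes "strongly_convex \<mu> f" "\<mu> \<ge> 0"
  shows "convex_on UNIV f"
proof (rule convex_onI)
  fix t :: real and x y :: 'a
  assume t: "0 < t" "t < 1"
  let ?z = "(1 - t) *\<^sub>R x + t *\<^sub>R y"
  have above: "f ?z + grad f ?z \<bullet> (u - ?z) \<le> f u" for u
  proof -
    have "f u \<ge> f ?z + grad f ?z \<bullet> (u - ?z) + \<mu> / 2 * (norm (u - ?z))\<^sup>2"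
      using assms(1) by (simp add: strongly_convex_def)
    moreover have "\<mu> / 2 * (norm (u - ?z))\<^sup>2 \<ge> 0"
      using assms(2) by simp
    ultimately show ?thesis by linarith
  qed
  have "(1 - t) * (f ?z + grad f ?z \<bullet> (x - ?z)) + t * (f ?z + grad f ?z \<bullet> (y - ?z))
      \<le> (1 - t) * f x + t * f y"
    using t above by (intro add_mono mult_left_mono) auto
  also have "(1 - t) * (f ?z + grad f ?z \<bullet> (x - ?z)) + t * (f ?z + grad f ?z \<bullet> (y - ?z)) = f ?z"
    by (simp add: algebra_simps)
  finally show "f ?z \<le> (1 - t) * f x + t * f y" .
qed simp

text \<open>Beyond the radius \<open>2 * norm (grad f 0) / \<mu>\<close> around the origin the quadratic lower bound
  exceeds \<open>f 0\<close>, so that minimizing over a compact ball suffices.\<close>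

lemma strongly_convex_minimizer_exists:
  fixes f :: "'a::euclidean_space \<Rightarrow> real"
  assumes "strongly_convex \<mu> f" "\<mu> > 0" "\<And>x. f differentiable (at x)"
  shows "\<exists>p. p \<in> minimizers f"
proof -
  define R where "R = 2 * norm (grad f 0) / \<mu>"
  have "R \<ge> 0"
    using assms(2) by (simp add: R_def)
  have "continuous_on (cball 0 R) f"
    using assms(3) by (intro differentiable_imp_continuous_on)
      (auto simp: differentiable_on_def intro: differentiable_at_withinI)
  then obtain p where p: "p \<in> cball 0 R" "\<And>x. x \<in> cball 0 R \<Longrightarrow> f p \<le> f x"
    using continuous_attains_inf[of "cball 0 R" f] \<open>R \<ge> 0\<close> by (auto simp del: mem_cball)
  have "f p \<le> f x" for x
  proof (cases "x \<in> cball 0 R")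
    case False
    then have "norm (grad f 0) \<le> \<mu> / 2 * norm x"
      using assms(2) by (simp add: R_def field_simps)
    then have "norm (grad f 0) * norm x \<le> \<mu> / 2 * norm x * norm x"
      by (intro mult_right_mono) auto
    moreover have "- (grad f 0 \<bullet> x) \<le> norm (grad f 0) * norm x"
      using norm_cauchy_schwarz[of "- grad f 0" x] by simp
    moreover have "f x \<ge> f 0 + grad f 0 \<bullet> (x - 0) + \<mu> / 2 * (norm (x - 0))\<^sup>2"
      using assms(1) unfolding strongly_convex_def by blast
    ultimately have "f 0 \<le> f x"
      by (simp add: power2_eq_square)
    then show ?thesis
      using p(2)[of 0] \<open>R \<ge> 0\<close> by simp
  qed (use p in blast)
  then show ?thesis
    by (auto simp: minimizers_def is_arg_min_linorder)
qed

lemma strongly_convex_growth: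
  fixes f :: "'a::euclidean_space \<Rightarrow> real"
  assumes "strongly_convex \<mu> f" "\<And>x. f differentiable (at x)" "p \<in> minimizers f"
  shows "\<mu> / 2 * (norm (x - p))\<^sup>2 \<le> f x - f p"
proof -
  have "f x \<ge> f p + grad f p \<bullet> (x - p) + \<mu> / 2 * (norm (x - p))\<^sup>2"
    using assms(1) by (simp add: strongly_convex_def)
  then show ?thesis
    using grad_minimizer_eq_0[OF assms(2,3)] by simp
qed

lemma strongly_convex_dist_le_grad:
  fixes f :: "'a::euclidean_space \<Rightarrow> real"
  assumes "strongly_convex \<mu> f" "\<And>x. f differentiable (at x)" "p \<in> minimizers f"
  shows "\<mu> * norm (x - p) \<le> norm (grad f x)"
proof (cases "x = p")
  case False
  have "f p \<ge> f x + grad f x \<bullet> (p - x) + \<mu> / 2 * (norm (p - x))\<^sup>2"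
    using assms(1) by (simp add: strongly_convex_def)
  moreover have "- (grad f x \<bullet> (p - x)) \<le> norm (grad f x) * norm (x - p)"
    using norm_cauchy_schwarz[of "- grad f x" "p - x"] by (simp add: norm_minus_commute)
  ultimately have "(\<mu> * norm (x - p)) * norm (x - p) \<le> norm (grad f x) * norm (x - p)"
    using strongly_convex_growth[OF assms, of x]
    by (simp add: norm_minus_commute power2_eq_square)
  then show ?thesis
    using False by simp
qed simp

lemma L_smooth_upper_bound:
  fixes f :: "'a::euclidean_space \<Rightarrow> real"
  assumes "L_smooth L f"
  shows "f y \<le> f x + grad f x \<bullet> (y - x) + L / 2 * (norm (y - x))\<^sup>2"
proof -
  define h where "h = y - x"
  let ?\<phi> = "\<lambda>t::real. f (x + t *\<^sub>R h) - t * (grad f x \<bullet> h) - L / 2 * t\<^sup>2 * (norm h)\<^sup>2"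
  have "?\<phi> 0 \<ge> ?\<phi> 1"
  proof (rule DERIV_nonpos_imp_nonincreasing[of 0 1 ?\<phi>])
    fix t :: real assume t: "0 \<le> t" "t \<le> 1"
    let ?D = "grad f (x + t *\<^sub>R h) \<bullet> h - grad f x \<bullet> h - L * t * (norm h)\<^sup>2"
    have "(?\<phi> has_real_derivative ?D) (at t)"
      using assms
      by (auto intro!: derivative_eq_intros DERIV_along_line simp: L_smooth_def power2_eq_square)
    moreover have "(grad f (x + t *\<^sub>R h) - grad f x) \<bullet> h \<le> L * t * (norm h)\<^sup>2"
    proof -
      have "norm (grad f (x + t *\<^sub>R h) - grad f x) \<le> L * norm ((x + t *\<^sub>R h) - x)"
        using assms unfolding L_smooth_def by blast
      also have "\<dots> = L * t * norm h"
        using t by simp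
      finally have "norm (grad f (x + t *\<^sub>R h) - grad f x) * norm h \<le> L * t * norm h * norm h"
        by (intro mult_right_mono) auto
      then show ?thesis
        using norm_cauchy_schwarz[of "grad f (x + t *\<^sub>R h) - grad f x" h]
        by (simp add: power2_eq_square)
    qed
    ultimately show "\<exists>D. (?\<phi> has_real_derivative D) (at t) \<and> D \<le> 0"
      by (intro exI[of _ ?D]) (simp add: inner_diff_left)
  qed simp
  then show ?thesis
    by (simp add: h_def)
qed

section \<open>The proximal function\<close>

lemma GDERIV_proximal:
  fixes f :: "'a::euclidean_space \<Rightarrow> real"
  assumes "f differentiable (at x)"
  shows "GDERIV (proximal f \<sigma> c) x :> grad f x + \<sigma> *\<^sub>R (x - c)"
proof -
  have "(f has_derivative (\<lambda>h. h \<bullet> grad f x)) (at x)"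
    using GDERIV_grad[OF assms] by (simp add: gderiv_def)
  then have "((\<lambda>x. f x + \<sigma> / 2 * ((x - c) \<bullet> (x - c))) has_derivative
      (\<lambda>h. h \<bullet> (grad f x + \<sigma> *\<^sub>R (x - c)))) (at x)"
    by (auto intro!: derivative_eq_intros simp: fun_eq_iff algebra_simps inner_commute)
  then show ?thesis
    by (simp add: gderiv_def proximal_def[abs_def] power2_norm_eq_inner)
qed

lemma grad_proximal:
  fixes f :: "'a::euclidean_space \<Rightarrow> real"
  assumes "f differentiable (at x)"
  shows "grad (proximal f \<sigma> c) x = grad f x + \<sigma> *\<^sub>R (x - c)"
  using GDERIV_proximal[OF assms] by (rule grad_eqI)

lemma differentiable_proximal:
  fixes f :: "'a::euclidean_space \<Rightarrow> real"
  assumes "f differentiable (at x)"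
  shows "proximal f \<sigma> c differentiable (at x)"
  using GDERIV_proximal[OF assms] unfolding gderiv_def by (rule differentiableI)

text \<open>The quadratic term equals its second-order expansion. Bounds on the linearization error of \<open>f\<close>
  from below and from above thus pass to the proximal function, which gives its strong convexity
  and the success of backtracking.\<close>

lemma proximal_linearization_error:
  fixes f :: "'a::euclidean_space \<Rightarrow> real"
  assumes "f differentiable (at x)"
  shows "proximal f \<sigma> c y - proximal f \<sigma> c x - grad (proximal f \<sigma> c) x \<bullet> (y - x)
    = f y - f x - grad f x \<bullet> (y - x) + \<sigma> / 2 * (norm (y - x))\<^sup>2"
proof -
  have expand: "(norm (y - c))\<^sup>2
      = (norm (x - c))\<^sup>2 + 2 * ((x - c) \<bullet> (y - x)) + (norm (y - x))\<^sup>2"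
    by (simp add: power2_norm_eq_inner algebra_simps inner_commute)
  show ?thesis
    unfolding proximal_def grad_proximal[OF assms] expand inner_add_left inner_scaleR_left
    by (simp add: distrib_left)
qed

lemma strongly_convex_proximal:
  fixes f :: "'a::euclidean_space \<Rightarrow> real"
  assumes "convex_on UNIV f" "\<And>x. f differentiable (at x)"
  shows "strongly_convex \<sigma> (proximal f \<sigma> c)"
  unfolding strongly_convex_def
proof (intro allI)
  fix x y
  show "proximal f \<sigma> c x \<ge> proximal f \<sigma> c y + grad (proximal f \<sigma> c) y \<bullet> (x - y)
      + \<sigma> / 2 * (norm (x - y))\<^sup>2"
    using proximal_linearization_error[OF assms(2), of \<sigma> c x y]
      convex_on_above_tangent[OF assms(1,2), of y x] by linarith
qed

text \<open>If \<open>c'\<close> is the weighted mean of \<open>c\<close> and \<open>x\<close>, then, up to a constant, the new proximal function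
  is the old one plus \<open>(\<sigma>' - \<sigma>) / 2 * (norm (u - x))\<^sup>2\<close>; adding this term pulls the minimizer
  towards \<open>x\<close>.\<close>

lemma proximal_minimizer_approaches_center:
  fixes f :: "'a::euclidean_space \<Rightarrow> real"
  assumes p: "p \<in> minimizers (proximal f \<sigma> c)"
    and q: "q \<in> minimizers (proximal f \<sigma>' c')"
    and c': "\<sigma>' *\<^sub>R c' = \<sigma> *\<^sub>R c + (\<sigma>' - \<sigma>) *\<^sub>R x"
    and "\<sigma> < \<sigma>'"
  shows "norm (q - x) \<le> norm (p - x)"
proof -
  define K where "K = \<sigma>' / 2 * (c' \<bullet> c') - \<sigma> / 2 * (c \<bullet> c) - (\<sigma>' - \<sigma>) / 2 * (x \<bullet> x)"
  have split: "proximal f \<sigma>' c' u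
      = proximal f \<sigma> c u + (\<sigma>' - \<sigma>) / 2 * (norm (u - x))\<^sup>2 + K" for u
  proof -
    have "u \<bullet> (\<sigma>' *\<^sub>R c') = u \<bullet> (\<sigma> *\<^sub>R c + (\<sigma>' - \<sigma>) *\<^sub>R x)"
      by (simp only: c')
    then have "\<sigma>' * (u \<bullet> c') = \<sigma> * (u \<bullet> c) + (\<sigma>' - \<sigma>) * (u \<bullet> x)"
      by (simp add: inner_add_right)
    then show ?thesis
      unfolding proximal_def K_def power2_norm_eq_inner
      by (simp add: inner_diff_left inner_diff_right inner_commute field_simps)
  qed
  have "proximal f \<sigma> c p \<le> proximal f \<sigma> c q" "proximal f \<sigma>' c' q \<le> proximal f \<sigma>' c' p"
    using p q by (auto simp: minimizers_def is_arg_min_linorder)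
  then have "(\<sigma>' - \<sigma>) / 2 * (norm (q - x))\<^sup>2 \<le> (\<sigma>' - \<sigma>) / 2 * (norm (p - x))\<^sup>2"
    using split[of q] split[of p] by linarith
  then have "(norm (q - x))\<^sup>2 \<le> (norm (p - x))\<^sup>2"
    using \<open>\<sigma> < \<sigma>'\<close> by simp
  then show ?thesis
    by (rule power2_le_imp_le) simp
qed

section \<open>Termination and cost of the inner procedures\<close>

text \<open>The test in the backtracking loop, with \<open>K = M + \<sigma>\<close> and \<open>d\<close> the gradient of \<open>g\<close> at \<open>x\<close>.\<close>

definition gradient_step_accepted ::
    "('a::real_inner \<Rightarrow> real) \<Rightarrow> real \<Rightarrow> 'a \<Rightarrow> 'a \<Rightarrow> bool" where
  "gradient_step_accepted g K x d \<longleftrightarrow>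
     (let x' = x - (1 / (2 * K)) *\<^sub>R d
      in g x' - g x - d \<bullet> (x' - x) \<le> K / 2 * (norm (x' - x))\<^sup>2)"

text \<open>A failing test needs \<open>M < L\<close>, because the proximal function has a quadratic upper
  bound with the constant \<open>L + \<sigma>\<close>. Hence doubling never leads beyond \<open>2 * L\<close>.\<close>

lemma backtracking_loop_terminates:
  fixes f :: "'a::euclidean_space \<Rightarrow> real"
  assumes smooth: "L_smooth L f" and d: "d = grad (proximal f \<sigma> c) x"
    and "0 < M" "M \<le> 2 * L"
  obtains M' where "backtracking_loop (proximal f \<sigma> c) \<sigma> x d M = Some M'"
    "0 < M'" "M' \<le> 2 * L" "gradient_step_accepted (proximal f \<sigma> c) (M' + \<sigma>) x d"
proof -
  define test where "test M = gradient_step_accepted (proximal f \<sigma> c) (M + \<sigma>) x d" for M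
  have loop: "backtracking_loop (proximal f \<sigma> c) \<sigma> x d M =
      (if test M then Some M else backtracking_loop (proximal f \<sigma> c) \<sigma> x d (2 * M))" for M
    by (subst backtracking_loop.simps) (simp add: test_def gradient_step_accepted_def Let_def)
  have passes: "test M" if "L \<le> M" for M
  proof -
    let ?y = "x - (1 / (2 * (M + \<sigma>))) *\<^sub>R d"
    have "f differentiable (at x)"
      using smooth by (simp add: L_smooth_def)
    then have "proximal f \<sigma> c ?y - proximal f \<sigma> c x - d \<bullet> (?y - x)
        = f ?y - f x - grad f x \<bullet> (?y - x) + \<sigma> / 2 * (norm (?y - x))\<^sup>2"
      unfolding d by (rule proximal_linearization_error)
    also have "\<dots> \<le> L / 2 * (norm (?y - x))\<^sup>2 + \<sigma> / 2 * (norm (?y - x))\<^sup>2"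
      using L_smooth_upper_bound[OF smooth, of ?y x] by simp
    also have "\<dots> = (L + \<sigma>) / 2 * (norm (?y - x))\<^sup>2"
      by (simp only: add_divide_distrib distrib_right)
    also have "\<dots> \<le> (M + \<sigma>) / 2 * (norm (?y - x))\<^sup>2"
      using that by (intro mult_right_mono) auto
    finally show ?thesis
      by (simp add: test_def gradient_step_accepted_def Let_def)
  qed
  have "\<exists>M'. backtracking_loop (proximal f \<sigma> c) \<sigma> x d M = Some M' \<and> 0 < M' \<and> M' \<le> 2 * L \<and> test M'"
    if "0 < M" "M \<le> 2 * L" "L \<le> 2 ^ n * M" for n M
    using that
  proof (induction n arbitrary: M)
    case 0
    then show ?case
      using passes[of M] loop[of M] by auto
  next
    case (Suc n)
    show ?case
    proof (cases "test M")
      case True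
      then show ?thesis
        using Suc.prems loop[of M] by auto
    next
      case False
      then have "M < L"
        using passes[of M] by linarith
      then show ?thesis
        using Suc.IH[of "2 * M"] Suc.prems loop[of M] False by (auto simp: mult.assoc mult.left_commute)
    qed
  qed
  moreover obtain n where "L / M < 2 ^ n"
    using real_arch_pow[of 2 "L / M"] by auto
  then have "L \<le> 2 ^ n * M"
    using \<open>0 < M\<close> by (simp add: field_simps)
  ultimately obtain M' where "backtracking_loop (proximal f \<sigma> c) \<sigma> x d M = Some M'"
      "0 < M'" "M' \<le> 2 * L" "test M'"
    using assms(3,4) by blast
  then show thesis
    using that unfolding test_def by blast
qed

text \<open>A failed stopping test at \<open>k\<close> forces \<open>k < 8 * sqrt (2 * B / \<sigma>)\<close>, so that \<open>k + 1\<close> still respects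
  the bound.\<close>

lemma subroutine_loop_terminates:
  assumes A: "\<And>k xk Lk. k \<ge> 1 \<Longrightarrow> A f \<sigma> c x0 k = (xk, Lk) \<Longrightarrow> Lk \<le> B"
    and "\<sigma> > 0" "k \<ge> 1" "real k \<le> 1 + 8 * sqrt (2 * B / \<sigma>)"
  shows "\<exists>xk k' Lk. subroutine_loop A f \<sigma> c x0 k = Some (xk, k') \<and> A f \<sigma> c x0 k' = (xk, Lk)
    \<and> k' \<ge> 1 \<and> 8 * sqrt (2 * Lk / \<sigma>) \<le> real k' \<and> real k' \<le> 1 + 8 * sqrt (2 * B / \<sigma>)"
  using assms(3,4)
proof (induction "nat \<lceil>1 + 8 * sqrt (2 * B / \<sigma>)\<rceil> - k" arbitrary: k rule: less_induct)
  case less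
  obtain xk Lk where xk: "A f \<sigma> c x0 k = (xk, Lk)"
    by (cases "A f \<sigma> c x0 k")
  show ?case
  proof (cases "8 * sqrt (2 * Lk / \<sigma>) \<le> real k")
    case True
    then have "subroutine_loop A f \<sigma> c x0 k = Some (xk, k)"
      by (subst subroutine_loop.simps) (simp add: xk)
    then show ?thesis
      using True xk less.prems by blast
  next
    case False
    have "sqrt (2 * Lk / \<sigma>) \<le> sqrt (2 * B / \<sigma>)"
      using A[OF less.prems(1) xk] \<open>\<sigma> > 0\<close> by (simp add: divide_right_mono)
    with False have "real k < 8 * sqrt (2 * B / \<sigma>)"
      by linarith
    then have next_le: "real (k + 1) \<le> 1 + 8 * sqrt (2 * B / \<sigma>)"
      by simp
    then have "nat \<lceil>1 + 8 * sqrt (2 * B / \<sigma>)\<rceil> - (k + 1)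
        < nat \<lceil>1 + 8 * sqrt (2 * B / \<sigma>)\<rceil> - k"
      by (intro diff_less_mono2) linarith+
    moreover have "subroutine_loop A f \<sigma> c x0 k = subroutine_loop A f \<sigma> c x0 (k + 1)"
      using False by (subst subroutine_loop.simps) (simp add: xk)
    ultimately show ?thesis
      using less.hyps[of "k + 1"] next_le by simp
  qed
qed

section \<open>The proximal point iteration\<close>

text \<open>The accepted step decreases \<open>g\<close> by at least \<open>3 / (8 * K) * (norm d)\<^sup>2\<close>, which cannot
  exceed the gap to the minimum.\<close>

lemma accepted_step_imp_norm_le_gap:
  fixes g :: "'a::euclidean_space \<Rightarrow> real"
  assumes "K > 0" and q: "q \<in> minimizers g"
    and test: "gradient_step_accepted g K x d"
  shows "3 * (norm d)\<^sup>2 \<le> 8 * K * (g x - g q)"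
proof -
  have "g q \<le> g (x - (1 / (2 * K)) *\<^sub>R d)"
    using q by (simp add: minimizers_def is_arg_min_linorder)
  moreover have "d \<bullet> ((x - (1 / (2 * K)) *\<^sub>R d) - x) = - ((norm d)\<^sup>2 / (2 * K))"
    by (simp add: power2_norm_eq_inner)
  moreover have "K / 2 * (norm ((x - (1 / (2 * K)) *\<^sub>R d) - x))\<^sup>2 = (norm d)\<^sup>2 / (8 * K)"
    using \<open>K > 0\<close> by (simp add: power_mult_distrib power2_eq_square field_simps)
  ultimately have "(norm d)\<^sup>2 / (2 * K) - (norm d)\<^sup>2 / (8 * K) \<le> g x - g q"
    using test unfolding gradient_step_accepted_def Let_def by linarith
  then show ?thesis
    using \<open>K > 0\<close> by (simp add: field_simps)
qed

text \<open>The stopping rule of the subroutine gives \<open>k\<^sup>2 \<ge> 128 * Lk / \<sigma>\<close>, whence the factor \<open>\<sigma> / 128\<close> in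
  the bound on the gap of the inexact proximal point \<open>x\<close>. Strong convexity turns this into a contraction of
  the distance, backtracking into a bound on the gradient.\<close>

lemma inexact_proximal_step:
  fixes f :: "'a::euclidean_space \<Rightarrow> real"
  assumes convex: "convex_on UNIV f" and diff: "\<And>x. f differentiable (at x)" and "\<sigma> > 0"
    and q: "q \<in> minimizers (proximal f \<sigma> c)"
    and gap: "proximal f \<sigma> c x - proximal f \<sigma> c q \<le> \<sigma> / 128 * (norm (x0 - q))\<^sup>2"
  shows "norm (x - q) \<le> norm (x0 - q) / 8"
    and "\<lbrakk>0 < M; M \<le> \<sigma>; d = grad (proximal f \<sigma> c) x;
      gradient_step_accepted (proximal f \<sigma> c) (M + \<sigma>) x d\<rbrakk>
      \<Longrightarrow> norm (grad f x) \<le> \<sigma> * norm (x - c) + \<sigma> / 4 * norm (x0 - q)"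
proof -
  let ?F = "proximal f \<sigma> c"
  have "\<sigma> / 2 * (norm (x - q))\<^sup>2 \<le> ?F x - ?F q"
    using strongly_convex_growth[OF strongly_convex_proximal[OF convex diff]
        differentiable_proximal[OF diff] q] .
  with gap have "\<sigma> * (norm (x - q))\<^sup>2 \<le> \<sigma> * (norm (x0 - q) / 8)\<^sup>2"
    by (simp add: power_divide)
  then have "(norm (x - q))\<^sup>2 \<le> (norm (x0 - q) / 8)\<^sup>2"
    using \<open>\<sigma> > 0\<close> by simp
  then show "norm (x - q) \<le> norm (x0 - q) / 8"
    by (rule power2_le_imp_le) simp
  assume M: "0 < M" "M \<le> \<sigma>" and d: "d = grad ?F x"
    and test: "gradient_step_accepted ?F (M + \<sigma>) x d"
  have "0 \<le> ?F x - ?F q"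
    using q by (simp add: minimizers_def is_arg_min_linorder)
  have "3 * (norm d)\<^sup>2 \<le> 8 * (M + \<sigma>) * (?F x - ?F q)"
    using accepted_step_imp_norm_le_gap[OF _ q test] M by simp
  also have "\<dots> \<le> 16 * \<sigma> * (?F x - ?F q)"
    using M \<open>0 \<le> ?F x - ?F q\<close> by (intro mult_right_mono) auto
  also have "\<dots> \<le> 16 * \<sigma> * (\<sigma> / 128 * (norm (x0 - q))\<^sup>2)"
    using gap \<open>\<sigma> > 0\<close> by (intro mult_left_mono) auto
  also have "\<dots> = (\<sigma> * norm (x0 - q))\<^sup>2 / 8"
    by (simp add: power_mult_distrib power2_eq_square)
  finally have "(norm d)\<^sup>2 \<le> (\<sigma> * norm (x0 - q))\<^sup>2 / 24"
    by simp
  also have "\<dots> \<le> (\<sigma> * norm (x0 - q))\<^sup>2 / 16"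
    by (intro divide_left_mono) auto
  also have "\<dots> = (\<sigma> / 4 * norm (x0 - q))\<^sup>2"
    by (simp add: power_mult_distrib power_divide)
  finally have "norm d \<le> \<sigma> / 4 * norm (x0 - q)"
    using \<open>\<sigma> > 0\<close> by (intro power2_le_imp_le[of "norm d"]) auto
  moreover have "grad f x = d - \<sigma> *\<^sub>R (x - c)"
    by (simp add: d grad_proximal[OF diff])
  then have "norm (grad f x) \<le> norm d + \<sigma> * norm (x - c)"
    using norm_triangle_ineq4[of d "\<sigma> *\<^sub>R (x - c)"] \<open>\<sigma> > 0\<close> by simp
  ultimately show "norm (grad f x) \<le> \<sigma> * norm (x - c) + \<sigma> / 4 * norm (x0 - q)"
    by linarith
qed

lemma subroutine_assumptionD:
  assumes "subroutine_assumption A cA L f" "\<sigma> > 0" "k \<ge> 1" "A f \<sigma> c x0 k = (xk, Lk)"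
  shows "0 \<le> Lk" "Lk \<le> cA * L"
    and "\<lbrakk>convex_on UNIV f; q \<in> minimizers (proximal f \<sigma> c)\<rbrakk>
      \<Longrightarrow> proximal f \<sigma> c xk - proximal f \<sigma> c q \<le> Lk / (real k)\<^sup>2 * (norm (x0 - q))\<^sup>2"
proof -
  have "case A f \<sigma> c x0 k of (xk, Lk) \<Rightarrow> 0 \<le> Lk \<and> Lk \<le> cA * L \<and>
      (convex_on UNIV f \<longrightarrow> (\<forall>q\<in>minimizers (proximal f \<sigma> c).
        proximal f \<sigma> c xk - proximal f \<sigma> c q \<le> Lk / (real k)\<^sup>2 * (norm (x0 - q))\<^sup>2))"
    using assms(1)[unfolded subroutine_assumption_def, THEN spec, THEN mp, OF assms(2),
        THEN spec, THEN spec, THEN spec, THEN mp, OF assms(3)] .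
  then show "0 \<le> Lk" "Lk \<le> cA * L"
    and "\<lbrakk>convex_on UNIV f; q \<in> minimizers (proximal f \<sigma> c)\<rbrakk>
      \<Longrightarrow> proximal f \<sigma> c xk - proximal f \<sigma> c q \<le> Lk / (real k)\<^sup>2 * (norm (x0 - q))\<^sup>2"
    by (simp_all add: assms(4))
qed

lemma subroutine_assumption_nonneg:
  assumes "subroutine_assumption A cA L f"
  shows "0 \<le> cA * L"
proof -
  obtain xk Lk where "A f 1 undefined undefined 1 = (xk, Lk)"
    by (rule prod.exhaust)
  then have "0 \<le> Lk" "Lk \<le> cA * L"
    using subroutine_assumptionD(1,2)[OF assms, of 1 1] by simp_all
  then show ?thesis
    by (rule order_trans)
qed

text \<open>The potential \<open>\<sigma>' * norm (x' - c') + 9 / 4 * \<sigma> * norm (x' - p)\<close>, where \<open>p\<close> minimizes the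
  previous proximal function, does not increase from one stage to the next, because \<open>\<sigma>\<close> grows by
  the factor \<open>4\<close> while the distance to the proximal point shrinks by the factor \<open>8\<close>. The constant
  \<open>9 / 4\<close> is the sum \<open>(1 + 1 / 8) * (1 + 1 / 2 + 1 / 4 + \<dots>)\<close> of the distances travelled, weighted
  by \<open>\<sigma>\<close>. In the last stage the potential bounds the gradient.\<close>

lemma ar_stage:
  fixes f :: "'a::euclidean_space \<Rightarrow> real"
  assumes smooth: "L_smooth L f" and A: "subroutine_assumption A cA L f"
    and \<sigma>: "0 \<le> \<sigma>'" "\<sigma>' < \<sigma>" and M: "0 < M" "M \<le> 4 * L"
  obtains x c M1 k where
    "\<And>N. ar_loop A f x' c' \<sigma>' \<sigma> M N =
       (if \<sigma> \<ge> M1 then Some (x, M1, N + k + 1) else ar_loop A f x c \<sigma> (4 * \<sigma>) M1 (N + k + 1))"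
    "0 < M1" "M1 \<le> 2 * L" "real k \<le> 1 + 8 * sqrt (2 * (cA * L) / \<sigma>)"
    "\<And>p. \<lbrakk>convex_on UNIV f; p \<in> minimizers (proximal f \<sigma>' c'); M1 \<le> \<sigma>\<rbrakk>
      \<Longrightarrow> norm (grad f x) \<le> \<sigma>' * norm (x' - c') + 9 / 4 * \<sigma> * norm (x' - p)"
    "\<And>p. \<lbrakk>convex_on UNIV f; p \<in> minimizers (proximal f \<sigma>' c')\<rbrakk>
      \<Longrightarrow> \<exists>q\<in>minimizers (proximal f \<sigma> c). \<sigma> * norm (x - c) + 9 / 4 * (4 * \<sigma>) * norm (x - q)
        \<le> \<sigma>' * norm (x' - c') + 9 / 4 * \<sigma> * norm (x' - p)"
proof -
  have diff: "\<And>x. f differentiable (at x)"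
    using smooth by (simp add: L_smooth_def)
  have "\<sigma> > 0" using \<sigma> by linarith
  define c where "c = (1 - (1 - \<sigma>' / \<sigma>)) *\<^sub>R c' + (1 - \<sigma>' / \<sigma>) *\<^sub>R x'"
  have c_mean: "\<sigma> *\<^sub>R c = \<sigma>' *\<^sub>R c' + (\<sigma> - \<sigma>') *\<^sub>R x'"
    using \<open>\<sigma> > 0\<close> by (simp add: c_def scaleR_right_distrib right_diff_distrib)
  have "1 \<le> 1 + 8 * sqrt (2 * (cA * L) / \<sigma>)"
    using subroutine_assumption_nonneg[OF A] \<open>\<sigma> > 0\<close> by simp
  then have "\<exists>x k Lk. subroutine_loop A f \<sigma> c x' 1 = Some (x, k) \<and> A f \<sigma> c x' k = (x, Lk)
      \<and> k \<ge> 1 \<and> 8 * sqrt (2 * Lk / \<sigma>) \<le> real k \<and> real k \<le> 1 + 8 * sqrt (2 * (cA * L) / \<sigma>)"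
    using subroutine_assumptionD(2)[OF A \<open>\<sigma> > 0\<close>] \<open>\<sigma> > 0\<close>
    by (intro subroutine_loop_terminates) simp_all
  then obtain x k Lk where sub: "subroutine_loop A f \<sigma> c x' 1 = Some (x, k)"
    and xk: "A f \<sigma> c x' k = (x, Lk)" and "k \<ge> 1" and stop: "8 * sqrt (2 * Lk / \<sigma>) \<le> real k"
    and k_le: "real k \<le> 1 + 8 * sqrt (2 * (cA * L) / \<sigma>)"
    by blast
  define d where "d = grad (proximal f \<sigma> c) x"
  obtain M1 where bt: "backtracking_loop (proximal f \<sigma> c) \<sigma> x d (M / 2) = Some M1"
    and M1: "0 < M1" "M1 \<le> 2 * L"
    and test: "gradient_step_accepted (proximal f \<sigma> c) (M1 + \<sigma>) x d"
    using backtracking_loop_terminates[OF smooth d_def, of "M / 2"] M by auto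
  have loop: "ar_loop A f x' c' \<sigma>' \<sigma> M N =
      (if \<sigma> \<ge> M1 then Some (x, M1, N + k + 1) else ar_loop A f x c \<sigma> (4 * \<sigma>) M1 (N + k + 1))" for N
    by (subst ar_loop.simps)
       (simp only: Let_def c_def[symmetric] run_subroutine_def backtracking_def sub
         bind.bind_lunit case_prod_conv d_def[symmetric] bt)
  have gap: "proximal f \<sigma> c x - proximal f \<sigma> c q \<le> \<sigma> / 128 * (norm (x' - q))\<^sup>2"
    if "convex_on UNIV f" "q \<in> minimizers (proximal f \<sigma> c)" for q
  proof -
    have Lk: "0 \<le> Lk" and conv: "proximal f \<sigma> c x - proximal f \<sigma> c q
        \<le> Lk / (real k)\<^sup>2 * (norm (x' - q))\<^sup>2"
      using subroutine_assumptionD(1,3)[OF A \<open>\<sigma> > 0\<close> \<open>k \<ge> 1\<close> xk] that by blast+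
    have "(8 * sqrt (2 * Lk / \<sigma>))\<^sup>2 \<le> (real k)\<^sup>2"
      using stop Lk \<open>\<sigma> > 0\<close> by (intro power_mono) auto
    then have "128 * Lk / \<sigma> \<le> (real k)\<^sup>2"
      using Lk \<open>\<sigma> > 0\<close> by (simp add: power_mult_distrib)
    then have "Lk / (real k)\<^sup>2 \<le> \<sigma> / 128"
      using \<open>\<sigma> > 0\<close> \<open>k \<ge> 1\<close> by (simp add: field_simps)
    then have "Lk / (real k)\<^sup>2 * (norm (x' - q))\<^sup>2 \<le> \<sigma> / 128 * (norm (x' - q))\<^sup>2"
      by (rule mult_right_mono) simp
    with conv show ?thesis by linarith
  qed
  have step: "\<exists>q\<in>minimizers (proximal f \<sigma> c). norm (x' - q) \<le> norm (x' - p)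
      \<and> norm (x - q) \<le> norm (x' - q) / 8
      \<and> \<sigma> * norm (x - c) \<le> \<sigma>' * norm (x' - c') + 9 / 8 * \<sigma> * norm (x' - q)
      \<and> (M1 \<le> \<sigma> \<longrightarrow> norm (grad f x) \<le> \<sigma> * norm (x - c) + \<sigma> / 4 * norm (x' - q))"
    if convex: "convex_on UNIV f" and p: "p \<in> minimizers (proximal f \<sigma>' c')" for p
  proof -
    obtain q where q: "q \<in> minimizers (proximal f \<sigma> c)"
      using strongly_convex_minimizer_exists[OF strongly_convex_proximal[OF convex diff] \<open>\<sigma> > 0\<close>]
        differentiable_proximal[OF diff] by blast
    have "norm (q - x') \<le> norm (p - x')"
      using proximal_minimizer_approaches_center[OF p q c_mean \<sigma>(2)] .
    moreover have xq: "norm (x - q) \<le> norm (x' - q) / 8"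
      using inexact_proximal_step(1)[OF convex diff \<open>\<sigma> > 0\<close> q gap[OF convex q]] .
    moreover have "\<sigma> * norm (x - c) \<le> \<sigma>' * norm (x' - c') + 9 / 8 * \<sigma> * norm (x' - q)"
    proof -
      have "\<sigma> *\<^sub>R (x - c) = \<sigma> *\<^sub>R ((x - q) - (x' - q)) + \<sigma>' *\<^sub>R (x' - c')"
        using c_mean by (simp add: algebra_simps)
      then have "norm (\<sigma> *\<^sub>R (x - c))
          \<le> norm (\<sigma> *\<^sub>R ((x - q) - (x' - q))) + norm (\<sigma>' *\<^sub>R (x' - c'))"
        using norm_triangle_ineq by metis
      then have "\<sigma> * norm (x - c) \<le> \<sigma> * norm ((x - q) - (x' - q)) + \<sigma>' * norm (x' - c')"
        using \<sigma> \<open>\<sigma> > 0\<close> by simp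
      also have "norm ((x - q) - (x' - q)) \<le> 9 / 8 * norm (x' - q)"
        using norm_triangle_ineq4[of "x - q" "x' - q"] xq by linarith
      finally show ?thesis
        using \<open>\<sigma> > 0\<close> by (simp add: mult_left_mono)
    qed
    moreover have "M1 \<le> \<sigma> \<longrightarrow> norm (grad f x) \<le> \<sigma> * norm (x - c) + \<sigma> / 4 * norm (x' - q)"
      using inexact_proximal_step(2)[OF convex diff \<open>\<sigma> > 0\<close> q gap[OF convex q] M1(1) _ d_def test]
      by blast
    ultimately show ?thesis
      using q by (auto simp: norm_minus_commute)
  qed
  show thesis
  proof (rule that[OF loop M1 k_le])
    fix p assume "convex_on UNIV f" "p \<in> minimizers (proximal f \<sigma>' c')" "M1 \<le> \<sigma>"
    then obtain q where "norm (x' - q) \<le> norm (x' - p)"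
        "\<sigma> * norm (x - c) \<le> \<sigma>' * norm (x' - c') + 9 / 8 * \<sigma> * norm (x' - q)"
        "norm (grad f x) \<le> \<sigma> * norm (x - c) + \<sigma> / 4 * norm (x' - q)"
      using step by blast
    moreover have "\<sigma> * norm (x' - q) \<le> \<sigma> * norm (x' - p)"
      using calculation(1) \<open>\<sigma> > 0\<close> by simp
    moreover have "0 \<le> \<sigma> * norm (x' - p)"
      using \<open>\<sigma> > 0\<close> by simp
    ultimately show "norm (grad f x) \<le> \<sigma>' * norm (x' - c') + 9 / 4 * \<sigma> * norm (x' - p)"
      by simp
  next
    fix p assume "convex_on UNIV f" "p \<in> minimizers (proximal f \<sigma>' c')"
    then obtain q where q: "q \<in> minimizers (proximal f \<sigma> c)" "norm (x' - q) \<le> norm (x' - p)"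
        "norm (x - q) \<le> norm (x' - q) / 8"
        "\<sigma> * norm (x - c) \<le> \<sigma>' * norm (x' - c') + 9 / 8 * \<sigma> * norm (x' - q)"
      using step by blast
    have "\<sigma> * norm (x' - q) \<le> \<sigma> * norm (x' - p)" "\<sigma> * norm (x - q) \<le> \<sigma> * (norm (x' - q) / 8)"
      using q \<open>\<sigma> > 0\<close> by (simp_all only: mult_le_cancel_left_pos)
    then show "\<exists>q\<in>minimizers (proximal f \<sigma> c). \<sigma> * norm (x - c)
        + 9 / 4 * (4 * \<sigma>) * norm (x - q) \<le> \<sigma>' * norm (x' - c') + 9 / 4 * \<sigma> * norm (x' - p)"
      using q by (intro bexI[of _ q]) simp_all
  qed
qed

text \<open>Since \<open>M1 \<le> 2 * L\<close> in every stage, \<open>n + 1\<close> stages suffice when \<open>2 * L \<le> 4 ^ n * \<sigma>\<close>. The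
  costs of the subroutine form a geometric series of ratio \<open>1 / 2\<close>.\<close>

lemma ar_loop_correct:
  fixes f :: "'a::euclidean_space \<Rightarrow> real"
  assumes smooth: "L_smooth L f" and A: "subroutine_assumption A cA L f"
    and "0 \<le> \<sigma>'" "\<sigma>' < \<sigma>" "0 < M" "M \<le> 4 * L" "2 * L \<le> 4 ^ n * \<sigma>"
  shows "\<exists>x M1 k. ar_loop A f x' c' \<sigma>' \<sigma> M N = Some (x, M1, N + k)
    \<and> 0 < M1 \<and> M1 \<le> 2 * L
    \<and> real k \<le> 2 * (real n + 1) + 16 * sqrt (2 * (cA * L) / \<sigma>)
    \<and> (convex_on UNIV f \<longrightarrow> (\<forall>p\<in>minimizers (proximal f \<sigma>' c').
         norm (grad f x) \<le> \<sigma>' * norm (x' - c') + 9 / 4 * \<sigma> * norm (x' - p)))"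
  using assms(3-)
proof (induction n arbitrary: x' c' \<sigma>' \<sigma> M N rule: less_induct)
  case (less n x' c' \<sigma>' \<sigma> M N)
  define a where "a = sqrt (2 * (cA * L) / \<sigma>)"
  obtain x c M1 k where loop: "\<And>N. ar_loop A f x' c' \<sigma>' \<sigma> M N =
       (if \<sigma> \<ge> M1 then Some (x, M1, N + k + 1) else ar_loop A f x c \<sigma> (4 * \<sigma>) M1 (N + k + 1))"
    and M1: "0 < M1" "M1 \<le> 2 * L" and k: "real k \<le> 1 + 8 * a"
    and last: "\<And>p. \<lbrakk>convex_on UNIV f; p \<in> minimizers (proximal f \<sigma>' c'); M1 \<le> \<sigma>\<rbrakk>
      \<Longrightarrow> norm (grad f x) \<le> \<sigma>' * norm (x' - c') + 9 / 4 * \<sigma> * norm (x' - p)"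
    and cont: "\<And>p. \<lbrakk>convex_on UNIV f; p \<in> minimizers (proximal f \<sigma>' c')\<rbrakk>
      \<Longrightarrow> \<exists>q\<in>minimizers (proximal f \<sigma> c). \<sigma> * norm (x - c) + 9 / 4 * (4 * \<sigma>) * norm (x - q)
        \<le> \<sigma>' * norm (x' - c') + 9 / 4 * \<sigma> * norm (x' - p)"
    unfolding a_def by (rule ar_stage[OF smooth A less.prems(1-4)]) blast
  have "0 \<le> a"
    using less.prems subroutine_assumption_nonneg[OF A] by (simp add: a_def)
  show ?case
  proof (cases "\<sigma> \<ge> M1")
    case True
    have "real (k + 1) \<le> 2 * (real n + 1) + 16 * a"
      using k \<open>0 \<le> a\<close> by simp
    moreover have "ar_loop A f x' c' \<sigma>' \<sigma> M N = Some (x, M1, N + (k + 1))"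
      using loop[of N] True by simp
    ultimately show ?thesis
      using M1 last[OF _ _ True] unfolding a_def by blast
  next
    case False
    then have "n \<noteq> 0"
      using M1 less.prems by (intro notI) simp
    then obtain m where n: "n = Suc m"
      by (cases n) auto
    have "sqrt (2 * (cA * L) / (4 * \<sigma>)) = sqrt (2 * (cA * L) / \<sigma> / 4)"
      by simp
    then have "sqrt (2 * (cA * L) / (4 * \<sigma>)) = a / 2"
      by (simp only: a_def real_sqrt_divide[of _ 4] real_sqrt_four)
    moreover have "0 \<le> \<sigma>" "\<sigma> < 4 * \<sigma>" "M1 \<le> 4 * L" "2 * L \<le> 4 ^ m * (4 * \<sigma>)"
      using less.prems M1 by (simp_all add: n)
    ultimately obtain y M2 l where IH: "ar_loop A f x c \<sigma> (4 * \<sigma>) M1 (N + k + 1)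
          = Some (y, M2, N + k + 1 + l)"
        "0 < M2" "M2 \<le> 2 * L" "real l \<le> 2 * (real m + 1) + 16 * (a / 2)"
        "convex_on UNIV f \<Longrightarrow> \<forall>q\<in>minimizers (proximal f \<sigma> c).
         norm (grad f y) \<le> \<sigma> * norm (x - c) + 9 / 4 * (4 * \<sigma>) * norm (x - q)"
      using less.IH[of m \<sigma> "4 * \<sigma>" M1 x c "N + k + 1"] M1(1) n by auto
    have "real (k + 1 + l) \<le> 2 * (real n + 1) + 16 * a"
      using k IH(4) n by simp
    moreover have "norm (grad f y) \<le> \<sigma>' * norm (x' - c') + 9 / 4 * \<sigma> * norm (x' - p)"
      if "convex_on UNIV f" "p \<in> minimizers (proximal f \<sigma>' c')" for p
      using cont[OF that] IH(5)[OF that(1)] by (force intro: order_trans)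
    moreover have "ar_loop A f x' c' \<sigma>' \<sigma> M N = Some (y, M2, N + (k + 1 + l))"
      using loop[of N] False IH(1) by (simp add: add.assoc)
    ultimately show ?thesis
      using IH(2,3) unfolding a_def by blast
  qed
qed

text \<open>With the least number \<open>n\<close> such that \<open>2 * L \<le> 4 ^ n * \<sigma>\<close>, the \<open>2 * n\<close> evaluations besides those
  covered by the geometric series are absorbed by the summand \<open>3\<close> in the definition of \<open>C1\<close>,
  since \<open>n \<le> 2 ^ (n - 1) \<le> sqrt (2 * L / \<sigma>)\<close> for \<open>n > 0\<close>.\<close>

lemma ar_correct:
  fixes f :: "'a::euclidean_space \<Rightarrow> real"
  assumes smooth: "L_smooth L f" and A: "subroutine_assumption A cA L f"
    and "0 < \<sigma>" "0 < M" "M \<le> 4 * L"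
  obtains y' M' k where "ar A f y \<sigma> M = Some (y', M', k)" "0 < M'" "M' \<le> 4 * L"
    "real k \<le> 2 + C1 cA * sqrt (L / \<sigma>)"
    "\<And>p. \<lbrakk>convex_on UNIV f; p \<in> minimizers f\<rbrakk> \<Longrightarrow> norm (grad f y') \<le> 9 / 4 * \<sigma> * norm (y - p)"
proof -
  have "L > 0" using assms(4,5) by linarith
  then have "cA \<ge> 0"
    using subroutine_assumption_nonneg[OF A] by (simp add: zero_le_mult_iff)
  define r where "r = sqrt (L / \<sigma>)"
  define u where "u = sqrt 2 * r"
  define n where "n = (LEAST n. 2 * L \<le> 4 ^ n * \<sigma>)"
  obtain n0 where "2 * L / \<sigma> < 4 ^ n0"
    using real_arch_pow[of 4 "2 * L / \<sigma>"] by auto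
  then have "2 * L \<le> 4 ^ n0 * \<sigma>"
    using \<open>0 < \<sigma>\<close> by (simp add: field_simps)
  then have n: "2 * L \<le> 4 ^ n * \<sigma>"
    unfolding n_def by (rule LeastI)
  have "real n \<le> u"
  proof (cases n)
    case 0
    then show ?thesis
      using \<open>L > 0\<close> \<open>0 < \<sigma>\<close> by (simp add: u_def r_def)
  next
    case (Suc m)
    then have "\<not> 2 * L \<le> 4 ^ m * \<sigma>"
      using not_less_Least[of m "\<lambda>n. 2 * L \<le> 4 ^ n * \<sigma>"] by (simp add: n_def)
    then have "(4::real) ^ m \<le> 2 * L / \<sigma>"
      using \<open>0 < \<sigma>\<close> by (simp add: field_simps)
    moreover have "(4::real) ^ m = (2 ^ m)\<^sup>2"
      by (simp add: power2_eq_square flip: power_mult_distrib)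
    ultimately have "2 ^ m \<le> sqrt (2 * L / \<sigma>)"
      by (simp add: real_le_rsqrt)
    also have "\<dots> = u"
      by (simp add: u_def r_def flip: real_sqrt_mult)
    finally have "2 ^ m \<le> u" .
    moreover have "Suc m \<le> 2 ^ m"
      by (intro Suc_leI less_exp)
    then have "real (Suc m) \<le> 2 ^ m"
      by (metis of_nat_le_iff of_nat_numeral of_nat_power)
    ultimately show ?thesis
      using Suc by linarith
  qed
  moreover
  define v where "v = sqrt 2 * (sqrt (2 * cA) * r)"
  define w where "w = sqrt (2 * (cA * L) / \<sigma>)"
  have "w \<le> v"
  proof -
    have "w = 1 * (sqrt (2 * cA) * r)"
      by (simp add: w_def r_def mult.assoc flip: real_sqrt_mult)
    also have "\<dots> \<le> sqrt 2 * (sqrt (2 * cA) * r)"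
      using \<open>L > 0\<close> \<open>0 < \<sigma>\<close> \<open>cA \<ge> 0\<close> by (intro mult_right_mono) (auto simp: r_def)
    finally show ?thesis
      unfolding v_def .
  qed
  moreover have "C1 cA * r = 3 * u + 16 * v"
    by (simp add: C1_def u_def v_def algebra_simps)
  moreover have "0 \<le> u"
    using \<open>L > 0\<close> \<open>0 < \<sigma>\<close> by (simp add: u_def r_def)
  ultimately have cost: "2 * (real n + 1) + 16 * w \<le> 2 + C1 cA * r"
    by simp
  obtain y' M' k where res: "ar_loop A f y y 0 \<sigma> M 0 = Some (y', M', 0 + k)" "0 < M'" "M' \<le> 2 * L"
    and k: "real k \<le> 2 * (real n + 1) + 16 * sqrt (2 * (cA * L) / \<sigma>)"
    and bound: "convex_on UNIV f \<Longrightarrow> \<forall>p\<in>minimizers (proximal f 0 y).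
         norm (grad f y') \<le> 0 * norm (y - y) + 9 / 4 * \<sigma> * norm (y - p)"
    using ar_loop_correct[OF smooth A order_refl \<open>0 < \<sigma>\<close> assms(4,5) n, of y y 0] by blast
  show thesis
  proof (rule that)
    show "ar A f y \<sigma> M = Some (y', M', k)"
      using res(1) by (simp add: ar_def)
    show "real k \<le> 2 + C1 cA * sqrt (L / \<sigma>)"
      using k cost unfolding w_def r_def by (rule order_trans)
    have "proximal f 0 y = f"
      by (simp add: proximal_def fun_eq_iff)
    then show "norm (grad f y') \<le> 9 / 4 * \<sigma> * norm (y - p)"
      if "convex_on UNIV f" "p \<in> minimizers f" for p
      using bound that by simp
  qed (use res \<open>L > 0\<close> in simp_all)
qed

section \<open>The outer loop\<close>

text \<open>One pass through the loop. For \<open>\<sigma> = \<mu> / 10\<close> the factor \<open>9 / 4 * \<sigma>\<close> is below \<open>\<mu> / 2\<close>.\<close>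

lemma scar_pm_stage:
  fixes f :: "'a::euclidean_space \<Rightarrow> real"
  assumes smooth: "L_smooth L f" and A: "subroutine_assumption A cA L f"
    and "0 < \<mu>" "0 < M" "M \<le> 4 * L"
  obtains y' M' k where
    "\<And>N. scar_pm_loop A f \<epsilon> y0 \<mu> y M N =
      (if norm (grad f y') \<le> \<epsilon> then Some (y', M', False, N + k)
       else if norm (grad f y') > norm (grad f y) / 2 then Some (y0, M', True, N + k)
       else scar_pm_loop A f \<epsilon> y0 \<mu> y' M' (N + k))"
    "0 < M'" "M' \<le> 4 * L" "real k \<le> 3 + C1 cA * sqrt (10 * L / \<mu>)"
    "\<And>p. \<lbrakk>convex_on UNIV f; p \<in> minimizers f\<rbrakk> \<Longrightarrow> norm (grad f y') \<le> \<mu> / 2 * norm (y - p)"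
proof -
  obtain y' M' k where ar: "ar A f y (\<mu> / 10) M = Some (y', M', k)" and M': "0 < M'" "M' \<le> 4 * L"
    and k: "real k \<le> 2 + C1 cA * sqrt (L / (\<mu> / 10))"
    and bound: "\<And>p. \<lbrakk>convex_on UNIV f; p \<in> minimizers f\<rbrakk>
      \<Longrightarrow> norm (grad f y') \<le> 9 / 4 * (\<mu> / 10) * norm (y - p)"
    using ar_correct[OF smooth A _ assms(4,5), of "\<mu> / 10" y]
      divide_pos_pos[OF \<open>0 < \<mu>\<close> zero_less_numeral] by metis
  show thesis
  proof (rule that[OF _ M'])
    show "scar_pm_loop A f \<epsilon> y0 \<mu> y M N =
      (if norm (grad f y') \<le> \<epsilon> then Some (y', M', False, N + (k + 1))
       else if norm (grad f y') > norm (grad f y) / 2 then Some (y0, M', True, N + (k + 1))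
       else scar_pm_loop A f \<epsilon> y0 \<mu> y' M' (N + (k + 1)))" for N
      by (subst scar_pm_loop.simps) (simp add: ar)
    show "real (k + 1) \<le> 3 + C1 cA * sqrt (10 * L / \<mu>)"
      using k by (simp add: mult.commute)
    show "norm (grad f y') \<le> \<mu> / 2 * norm (y - p)"
      if "convex_on UNIV f" "p \<in> minimizers f" for p
    proof -
      have "9 / 4 * (\<mu> / 10) * norm (y - p) \<le> \<mu> / 2 * norm (y - p)"
        using \<open>0 < \<mu>\<close> by (intro mult_right_mono) auto
      then show ?thesis
        using bound[OF that] by linarith
    qed
  qed
qed

text \<open>For a strongly convex function the distance to the minimizer is at most
  \<open>norm (grad f y) / \<mu>\<close>. Each pass therefore at least halves the norm of the gradient, so that ERROR
  refutes strong convexity.\<close>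

lemma scar_pm_loop_correct:
  fixes f :: "'a::euclidean_space \<Rightarrow> real"
  assumes smooth: "L_smooth L f" and A: "subroutine_assumption A cA L f"
    and "0 < \<mu>" "0 < M" "M \<le> 4 * L" "\<epsilon> < norm (grad f y)" "norm (grad f y) \<le> 2 ^ m * \<epsilon>"
  shows "\<exists>xhat Mhat ERROR k. scar_pm_loop A f \<epsilon> y0 \<mu> y M N = Some (xhat, Mhat, ERROR, N + k)
    \<and> (\<not> ERROR \<longrightarrow> norm (grad f xhat) \<le> \<epsilon>)
    \<and> (ERROR \<longrightarrow> \<not> strongly_convex \<mu> f)
    \<and> real k \<le> real m * (3 + C1 cA * sqrt (10 * L / \<mu>))"
  using assms(4-)
proof (induction m arbitrary: y M N)
  case (Suc m y M N)
  define P where "P = 3 + C1 cA * sqrt (10 * L / \<mu>)"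
  have diff: "\<And>x. f differentiable (at x)"
    using smooth by (simp add: L_smooth_def)
  obtain y' M' k where loop: "\<And>N. scar_pm_loop A f \<epsilon> y0 \<mu> y M N =
      (if norm (grad f y') \<le> \<epsilon> then Some (y', M', False, N + k)
       else if norm (grad f y') > norm (grad f y) / 2 then Some (y0, M', True, N + k)
       else scar_pm_loop A f \<epsilon> y0 \<mu> y' M' (N + k))"
    and M': "0 < M'" "M' \<le> 4 * L" and k: "real k \<le> P"
    and bound: "\<And>p. \<lbrakk>convex_on UNIV f; p \<in> minimizers f\<rbrakk>
      \<Longrightarrow> norm (grad f y') \<le> \<mu> / 2 * norm (y - p)"
    using scar_pm_stage[OF smooth A \<open>0 < \<mu>\<close> Suc.prems(1,2), of \<epsilon> y0 y]
    unfolding P_def by metis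
  have "0 \<le> P"
    using k of_nat_0_le_iff order_trans by blast
  then have "real k \<le> real (Suc m) * P"
    using k by (simp add: distrib_right add_increasing2)
  consider "norm (grad f y') \<le> \<epsilon>"
    | "norm (grad f y') > \<epsilon>" "norm (grad f y') > norm (grad f y) / 2"
    | "norm (grad f y') > \<epsilon>" "norm (grad f y') \<le> norm (grad f y) / 2"
    by linarith
  then show ?case
  proof cases
    case 1
    then show ?thesis
      using loop[of N] \<open>real k \<le> real (Suc m) * P\<close> unfolding P_def by auto
  next
    case 2
    have "\<not> strongly_convex \<mu> f"
    proof
      assume sc: "strongly_convex \<mu> f"
      then obtain p where p: "p \<in> minimizers f"
        using strongly_convex_minimizer_exists[OF _ \<open>0 < \<mu>\<close> diff] by blast
      have "norm (grad f y') \<le> \<mu> / 2 * norm (y - p)"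
        using bound strongly_convex_imp_convex_on[OF sc] p \<open>0 < \<mu>\<close> by simp
      moreover have "\<mu> * norm (y - p) \<le> norm (grad f y)"
        using strongly_convex_dist_le_grad[OF sc diff p] .
      ultimately show False
        using 2 by simp
    qed
    then show ?thesis
      using loop[of N] 2 \<open>real k \<le> real (Suc m) * P\<close> unfolding P_def by auto
  next
    case 3
    have "norm (grad f y') \<le> 2 ^ m * \<epsilon>"
      using 3 Suc.prems(4) by simp
    then obtain xhat Mhat ERROR l where
        IH: "scar_pm_loop A f \<epsilon> y0 \<mu> y' M' (N + k) = Some (xhat, Mhat, ERROR, N + k + l)"
        "\<not> ERROR \<longrightarrow> norm (grad f xhat) \<le> \<epsilon>" "ERROR \<longrightarrow> \<not> strongly_convex \<mu> f"
        and l: "real l \<le> real m * P"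
      using Suc.IH[OF M' 3(1), of "N + k"] unfolding P_def by blast
    have "scar_pm_loop A f \<epsilon> y0 \<mu> y M N = Some (xhat, Mhat, ERROR, N + (k + l))"
      using loop[of N] 3 IH(1) by (simp add: add.assoc)
    moreover have "real (k + l) \<le> real (Suc m) * P"
      using k l by (simp add: distrib_right)
    ultimately show ?thesis
      using IH(2,3) unfolding P_def by blast
  qed
qed simp

text \<open>For convex \<open>f\<close>, the first pass alone brings the norm of the gradient down to
  \<open>\<mu> / 2 * infdist y (minimizers f) \<le> 2 powi (j - 1) * \<epsilon>\<close>, whatever it was before. If there is no
  minimizer, then \<open>infdist\<close> is \<open>0\<close> and so is the quotient, contradicting \<open>0 < \<mu>\<close>.\<close>

lemma scar_pm_loop_convex_cost:
  fixes f :: "'a::euclidean_space \<Rightarrow> real"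
  assumes smooth: "L_smooth L f" and A: "subroutine_assumption A cA L f"
    and "0 < \<mu>" "0 < M" "M \<le> 4 * L" "0 < \<epsilon>" and convex: "convex_on UNIV f"
    and \<mu>: "\<mu> \<le> 2 powi j * \<epsilon> / infdist y (minimizers f)"
  shows "\<exists>xhat Mhat ERROR k. scar_pm_loop A f \<epsilon> y0 \<mu> y M N = Some (xhat, Mhat, ERROR, N + k)
    \<and> real k \<le> of_int (max 1 j) * (3 + C1 cA * sqrt (10 * L / \<mu>))"
proof -
  define P where "P = 3 + C1 cA * sqrt (10 * L / \<mu>)"
  obtain y' M' k where loop: "\<And>N. scar_pm_loop A f \<epsilon> y0 \<mu> y M N =
      (if norm (grad f y') \<le> \<epsilon> then Some (y', M', False, N + k)
       else if norm (grad f y') > norm (grad f y) / 2 then Some (y0, M', True, N + k)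
       else scar_pm_loop A f \<epsilon> y0 \<mu> y' M' (N + k))"
    and M': "0 < M'" "M' \<le> 4 * L" and k: "real k \<le> P"
    and bound: "\<And>p. \<lbrakk>convex_on UNIV f; p \<in> minimizers f\<rbrakk>
      \<Longrightarrow> norm (grad f y') \<le> \<mu> / 2 * norm (y - p)"
    using scar_pm_stage[OF smooth A \<open>0 < \<mu>\<close> assms(4,5), of \<epsilon> y0 y]
    unfolding P_def by metis
  have "0 \<le> P"
    using k of_nat_0_le_iff order_trans by blast
  then have "1 * P \<le> of_int (max 1 j) * P"
    by (intro mult_right_mono) auto
  then have k': "real k \<le> of_int (max 1 j) * P"
    using k by linarith
  have dist: "infdist y (minimizers f) \<noteq> 0"
    using \<mu> \<open>0 < \<mu>\<close> by auto
  then have "minimizers f \<noteq> {}"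
    by (auto simp: infdist_def)
  moreover have "2 * norm (grad f y') / \<mu> \<le> dist y p" if "p \<in> minimizers f" for p
    using bound[OF convex that] \<open>0 < \<mu>\<close> by (simp add: dist_norm field_simps)
  ultimately have "2 * norm (grad f y') / \<mu> \<le> infdist y (minimizers f)"
    by (simp add: infdist_notempty cINF_greatest)
  moreover have "infdist y (minimizers f) > 0"
    using dist infdist_nonneg[of y "minimizers f"] by linarith
  ultimately have first: "2 * norm (grad f y') \<le> 2 powi j * \<epsilon>"
    using \<mu> \<open>0 < \<mu>\<close> by (simp add: field_simps)
  show ?thesis
  proof (cases "norm (grad f y') \<le> \<epsilon> \<or> norm (grad f y') > norm (grad f y) / 2")
    case True
    then show ?thesis
      using loop[of N] k' unfolding P_def by (auto split: if_splits)
  next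
    case False
    then have "2 * \<epsilon> < 2 powi j * \<epsilon>"
      using first by linarith
    then have "(2::real) powi 1 < 2 powi j"
      using \<open>0 < \<epsilon>\<close> by simp
    then have "1 < j"
      by (smt (verit) power_int_increasing)
    define m where "m = nat (j - 1)"
    have "2 powi j = 2 * (2::real) ^ m"
    proof -
      have "j = int (Suc m)"
        using \<open>1 < j\<close> by (simp add: m_def)
      then show ?thesis
        by (metis power_Suc power_int_of_nat)
    qed
    then have "norm (grad f y') \<le> 2 ^ m * \<epsilon>"
      using first by simp
    then obtain xhat Mhat ERROR l where
        res: "scar_pm_loop A f \<epsilon> y0 \<mu> y' M' (N + k) = Some (xhat, Mhat, ERROR, N + k + l)"
        and l: "real l \<le> real m * P"
      using scar_pm_loop_correct[OF smooth A \<open>0 < \<mu>\<close> M', of \<epsilon> y' m y0 "N + k"] False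
      unfolding P_def by auto
    have "of_int (max 1 j) = 1 + real m"
      using \<open>1 < j\<close> by (simp add: m_def)
    then have "real (k + l) \<le> of_int (max 1 j) * P"
      using k l by (simp add: distrib_right)
    moreover have "scar_pm_loop A f \<epsilon> y0 \<mu> y M N = Some (xhat, Mhat, ERROR, N + (k + l))"
      using loop[of N] False res by (simp add: add.assoc)
    ultimately show ?thesis
      unfolding P_def by blast
  qed
qed

theorem theorem7p1:
  fixes A :: "(real ^ 'n) subroutine" and f :: "real ^ 'n \<Rightarrow> real"
    and cA L \<epsilon> \<mu> M0 :: real and y0 :: "real ^ 'n"
  assumes "L_smooth L f"
    and "subroutine_assumption A cA L f"
    and "\<epsilon> > 0" and "\<mu> > 0" and "0 < M0" and "M0 \<le> 4 * L"
    and "norm (grad f y0) > \<epsilon>"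
  shows "\<exists>xhat Mhat ERROR N. scar_pm A f \<epsilon> y0 \<mu> M0 = Some (xhat, Mhat, ERROR, N) \<and>
    (\<not> ERROR \<longrightarrow> norm (grad f xhat) \<le> \<epsilon>) \<and>
    (ERROR \<longrightarrow> \<not> strongly_convex \<mu> f) \<and>
    real N \<le> (4 + C1 cA * sqrt (10 * L / \<mu>)) * of_int \<lceil>log 2 (norm (grad f y0) / \<epsilon>)\<rceil> \<and>
    (\<forall>j::int. convex_on UNIV f \<and> \<mu> \<le> 2 powi j * \<epsilon> / infdist y0 (minimizers f) \<longrightarrow>
      real N \<le> (4 + C1 cA * sqrt (10 * L / \<mu>)) * of_int (max 1 j))"
proof -
  define P where "P = 3 + C1 cA * sqrt (10 * L / \<mu>)"
  define g where "g = norm (grad f y0)"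
  define m where "m = nat \<lceil>log 2 (g / \<epsilon>)\<rceil>"
  have "1 < g / \<epsilon>"
    using assms(3,7) by (simp add: g_def)
  then have "0 < log 2 (g / \<epsilon>)"
    by simp
  then have m: "of_int \<lceil>log 2 (g / \<epsilon>)\<rceil> = real m" "1 \<le> real m"
    by (simp_all add: m_def)
  have "g / \<epsilon> = 2 powr log 2 (g / \<epsilon>)"
    using \<open>1 < g / \<epsilon>\<close> by simp
  also have "\<dots> \<le> 2 powr real m"
    using le_of_int_ceiling[of "log 2 (g / \<epsilon>)"] unfolding m(1) by simp
  finally have "g \<le> 2 ^ m * \<epsilon>"
    using assms(3) by (simp add: powr_realpow field_simps)
  then obtain xhat Mhat ERROR k where
      res: "scar_pm_loop A f \<epsilon> y0 \<mu> y0 M0 1 = Some (xhat, Mhat, ERROR, 1 + k)"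
    and correct: "\<not> ERROR \<longrightarrow> norm (grad f xhat) \<le> \<epsilon>" "ERROR \<longrightarrow> \<not> strongly_convex \<mu> f"
    and k: "real k \<le> real m * P"
    using scar_pm_loop_correct[OF assms(1,2,4-7), of m y0 1] unfolding g_def P_def by blast
  \<comment> \<open>The evaluation at \<open>y0\<close> is charged to the first pass, whence \<open>4\<close> in place of \<open>3\<close>.\<close>
  have total: "real (1 + k) \<le> (4 + C1 cA * sqrt (10 * L / \<mu>)) * a"
    if "real k \<le> a * P" "1 \<le> a" for a
    using that by (simp add: P_def algebra_simps)
  have "real (1 + k) \<le> (4 + C1 cA * sqrt (10 * L / \<mu>)) * of_int (max 1 j)"
    if "convex_on UNIV f" "\<mu> \<le> 2 powi j * \<epsilon> / infdist y0 (minimizers f)" for j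
  proof -
    have "real k \<le> of_int (max 1 j) * P"
      using scar_pm_loop_convex_cost[OF assms(1,2,4-6,3) that, of y0 1] res unfolding P_def by auto
    then show ?thesis
      by (rule total) simp
  qed
  moreover have "real (1 + k) \<le> (4 + C1 cA * sqrt (10 * L / \<mu>)) * of_int \<lceil>log 2 (g / \<epsilon>)\<rceil>"
    unfolding m(1) using k m(2) by (rule total)
  moreover have "scar_pm A f \<epsilon> y0 \<mu> M0 = Some (xhat, Mhat, ERROR, 1 + k)"
    using res by (simp add: scar_pm_def)
  ultimately show ?thesis
    using correct unfolding g_def by blast
qed

end
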